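(* For every constant integer $t\ge4$, there exists an arrangement $L$ of $n$ lines in $\mathbb{R}^3$ such that there is no subset of more than $O(\sqrt n)$ lines of $L$ that are all stabbed by one line, nor any subset of more than $O(\sqrt n)$ lines of $L$ with no $t$ of them stabbed by one line.
   Context: A set $S$ of lines in $\mathbb{R}^3$ is stabbed by a line $m$ if $m$ intersects every line of $S$. The constants in $O(\cdot)$ depend only on $t$. *)

theory Defs
  imports "HOL-Analysis.Analysis"
begin

definition is_line :: "(real ^ 3) set \<Rightarrow> bool" where
  "is_line l \<longleftrightarrow> affine l \<and> aff_dim l = 1"

text \<open>Two lines intersect if they have a common point; in particular every line intersects itself,
  so the stabbing line may belong to the stabbed set. Parallel lines do not intersect.\<close>

definition stabbed_by :: "(real ^ 3) set set \<Rightarrow> (real ^ 3) set \<Rightarrow> bool" where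
  "stabbed_by S m \<longleftrightarrow> is_line m \<and> (\<forall>l\<in>S. m \<inter> l \<noteq> {})"

definition stabbed :: "(real ^ 3) set set \<Rightarrow> bool" where
  "stabbed S \<longleftrightarrow> (\<exists>m. stabbed_by S m)"

definition line_arrangement :: "nat \<Rightarrow> (real ^ 3) set set \<Rightarrow> bool" where
  "line_arrangement n L \<longleftrightarrow> finite L \<and> card L = n \<and> (\<forall>l\<in>L. is_line l)"

end

theory Submission imports Defs begin

text \<open>The lines \<open>ruling c s\<close> with \<open>c\<close> fixed rule the cubic surface \<open>z = x\<^sup>2 (y - c)\<close>, and all of them
  meet the line \<open>y = c, z = 0\<close>. Any other line meets at most three of them, since the parameters
  \<open>s\<close> of the rulings that it meets are roots of a nonzero cubic. For \<open>k\<close> about \<open>\<surd>n\<close>, take \<open>n\<close> of the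
  \<open>k\<^sup>2\<close> lines \<open>ruling i j\<close> with \<open>0 \<le> i < k\<close>, \<open>1 \<le> j \<le> k\<close>. A line stabs at most \<open>3\<close> lines in each of the \<open>k\<close>
  groups, apart from at most one group in which it may stab \<open>k\<close>; and a set with
  more than \<open>(t - 1) k\<close> lines has \<open>t\<close> lines in one group, which are stabbed.\<close>

definition ruling :: "real \<Rightarrow> real \<Rightarrow> (real ^ 3) set" where
  "ruling c s = {x. x $ 1 = s \<and> x $ 3 = s\<^sup>2 * (x $ 2 - c)}"

section \<open>Parametrized lines in space\<close>

lemma is_line_iff: "is_line m \<longleftrightarrow> (\<exists>p q. p \<noteq> q \<and> m = affine hull {p, q})"
proof
  assume m: "is_line m"
  obtain B where B: "affine hull B = affine hull m" "of_nat (card B) = aff_dim m + 1"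
    using aff_dim_basis_exists by metis
  with m have "card B = 2" "affine hull B = m"
    by (auto simp: is_line_def affine_hull_eq)
  then show "\<exists>p q. p \<noteq> q \<and> m = affine hull {p, q}"
    by (metis card_2_iff)
next
  assume "\<exists>p q. p \<noteq> q \<and> m = affine hull {p, q}"
  then show "is_line m"
    by (auto simp: is_line_def aff_dim_2)
qed

lemma affine_hull_2_eq_range:
  fixes p q :: "'a::real_vector"
  shows "affine hull {p, q} = range (\<lambda>u. p + u *\<^sub>R (q - p))"
proof -
  have "affine hull {p, q} = range (\<lambda>u. (1 - u) *\<^sub>R p + u *\<^sub>R q)"
  proof (intro equalityI subsetI)
    fix x assume "x \<in> affine hull {p, q}"
    then obtain v u where "x = v *\<^sub>R p + u *\<^sub>R q" "v + u = 1"
      by (auto simp: affine_hull_2)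
    moreover from this have "v = 1 - u" by simp
    ultimately show "x \<in> range (\<lambda>u. (1 - u) *\<^sub>R p + u *\<^sub>R q)" by blast
  next
    fix x assume "x \<in> range (\<lambda>u. (1 - u) *\<^sub>R p + u *\<^sub>R q)"
    then obtain u where "x = (1 - u) *\<^sub>R p + u *\<^sub>R q" by blast
    moreover have "(1 - u) + u = 1" by simp
    ultimately show "x \<in> affine hull {p, q}"
      unfolding affine_hull_2 by blast
  qed
  then show ?thesis
    by (simp add: algebra_simps)
qed

section \<open>The rulings and the lines that meet them\<close>

lemma ruling_eq_affine_hull:
  "ruling c s = affine hull {vector [s, c, 0], vector [s, c + 1, s\<^sup>2]}"
  unfolding affine_hull_2_eq_range ruling_def
  by (auto simp: vec_eq_iff forall_3 image_iff algebra_simps)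
     (rule_tac x = "x $ 2 - c" in exI, auto simp: algebra_simps)

lemma is_line_ruling: "is_line (ruling c s)"
  unfolding ruling_eq_affine_hull is_line_iff
  by (intro exI conjI) (auto simp: vec_eq_iff forall_3)

text \<open>The point \<open>(s, c, 0)\<close> of the first line lies on the second, which forces
  \<open>s = s'\<close> and \<open>s\<^sup>2 * (c - c') = 0\<close>.\<close>

lemma ruling_eq_iff: "ruling c s = ruling c' s' \<longleftrightarrow> s = s' \<and> (s = 0 \<or> c = c')"
proof
  assume eq: "ruling c s = ruling c' s'"
  have "vector [s, c, 0] \<in> ruling c s"
    by (simp add: ruling_def)
  then have "vector [s, c, 0] \<in> ruling c' s'"
    using eq by simp
  then show "s = s' \<and> (s = 0 \<or> c = c')"
    by (auto simp: ruling_def)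
qed (auto simp: ruling_def)

lemma stabbed_rulings:
  assumes "T \<subseteq> range (ruling c)"
  shows "stabbed T"
proof -
  let ?m = "affine hull {vector [0, c, 0], vector [1, c, 0]} :: (real ^ 3) set"
  have "vector [s, c, 0] \<in> ?m \<inter> ruling c s" for s
    by (auto simp: affine_hull_2_eq_range image_iff ruling_def vec_eq_iff forall_3)
  then have "\<forall>l\<in>T. ?m \<inter> l \<noteq> {}"
    using assms by blast
  moreover have "is_line ?m"
    unfolding is_line_iff by (intro exI conjI) (auto simp: vec_eq_iff forall_3)
  ultimately show ?thesis
    unfolding stabbed_def stabbed_by_def by blast
qed

text \<open>All lines in the plane \<open>y = c\<close> are set aside, not just the common stabber
  \<open>y = c, z = 0\<close>: a line lies in at most one such plane, so this still exempts at most
  one group.\<close>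

lemma line_meets_at_most_three_rulings:
  assumes "is_line m" and "\<not> (\<forall>x\<in>m. x $ 2 = c)"
  shows "finite {s. m \<inter> ruling c s \<noteq> {}} \<and> card {s. m \<inter> ruling c s \<noteq> {}} \<le> 3"
proof -
  obtain a b where m: "m = range (\<lambda>u. a + u *\<^sub>R (b - a))" and "a \<noteq> b"
    using assms(1) by (auto simp: is_line_iff affine_hull_2_eq_range)
  define d where "d = b - a"
  have meets: "m \<inter> ruling c s \<noteq> {} \<longleftrightarrow>
      (\<exists>u. a $ 1 + u * d $ 1 = s \<and> a $ 3 + u * d $ 3 = s\<^sup>2 * (a $ 2 + u * d $ 2 - c))" for s
    by (simp add: m ruling_def d_def disjoint_iff)
  show ?thesis
  proof (cases "d $ 1 = 0")
    case True
    then have sub: "{s. m \<inter> ruling c s \<noteq> {}} \<subseteq> {a $ 1}"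
      by (auto simp: meets)
    then show ?thesis
      using card_mono[OF _ sub] finite_subset[OF sub] by simp
  next
    case False
    \<comment> \<open>Multiply the incidence equation by \<open>d $ 1\<close> and eliminate
      \<open>u\<close> through \<open>u * d $ 1 = s - a $ 1\<close>; this leaves a cubic in
      \<open>s\<close>.\<close>
    define f where "f = [:a $ 1 * d $ 3 - a $ 3 * d $ 1, - d $ 3,
      (a $ 2 - c) * d $ 1 - a $ 1 * d $ 2, d $ 2:]"
    have sub: "{s. m \<inter> ruling c s \<noteq> {}} \<subseteq> {s. poly f s = 0}"
    proof (auto simp: meets)
      fix u
      assume eq: "a $ 3 + u * d $ 3 = (a $ 1 + u * d $ 1)\<^sup>2 * (a $ 2 + u * d $ 2 - c)"
      have "poly f (a $ 1 + u * d $ 1) =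
          d $ 1 * ((a $ 1 + u * d $ 1)\<^sup>2 * (a $ 2 + u * d $ 2 - c) - (a $ 3 + u * d $ 3))"
        unfolding f_def by (simp add: algebra_simps power2_eq_square)
      with eq show "poly f (a $ 1 + u * d $ 1) = 0"
        by simp
    qed
    have "f \<noteq> 0"
    proof
      assume "f = 0"
      \<comment> \<open>The two top coefficients suffice: \<open>d $ 2\<close> vanishes, and then so
        does \<open>(a $ 2 - c) * d $ 1\<close>, where \<open>d $ 1\<close> is nonzero.\<close>
      then have "d $ 2 = 0" "a $ 2 = c"
        using False by (auto simp: f_def)
      then have "\<forall>x\<in>m. x $ 2 = c"
        by (auto simp: m d_def)
      with assms(2) show False by simp
    qed
    moreover have "degree f \<le> 3"
      unfolding f_def by (simp add: degree_pCons_eq_if)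
    ultimately have "finite {s. poly f s = 0}" "card {s. poly f s = 0} \<le> 3"
      using poly_roots_finite[of f] card_poly_roots_bound[of f] by simp_all
    then show ?thesis
      using card_mono[OF _ sub] finite_subset[OF sub] by simp
  qed
qed

lemma card_stabbed_rulings_le:
  assumes "stabbed_by S m" "\<not> (\<forall>x\<in>m. x $ 2 = c)"
  shows "card (S \<inter> range (ruling c)) \<le> 3"
proof -
  have *: "finite {s. m \<inter> ruling c s \<noteq> {}}" "card {s. m \<inter> ruling c s \<noteq> {}} \<le> 3"
    using line_meets_at_most_three_rulings assms by (auto simp: stabbed_by_def)
  have "S \<inter> range (ruling c) \<subseteq> ruling c ` {s. m \<inter> ruling c s \<noteq> {}}"
    using assms(1) by (auto simp: stabbed_by_def)
  then have "card (S \<inter> range (ruling c)) \<le> card {s. m \<inter> ruling c s \<noteq> {}}"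
    using *(1) by (meson surj_card_le)
  with *(2) show ?thesis by simp
qed

section \<open>Groups of \<open>k\<close> rulings and the two counts\<close>

text \<open>The parameter \<open>s = 0\<close> is avoided because \<open>ruling c 0\<close> does not depend on \<open>c\<close>.\<close>

definition ruling_group :: "nat \<Rightarrow> nat \<Rightarrow> (real ^ 3) set set" where
  "ruling_group k i = (\<lambda>j. ruling (real i) (real j)) ` {1..k}"

lemma finite_ruling_group: "finite (ruling_group k i)"
  by (simp add: ruling_group_def)

lemma card_ruling_group_le: "card (ruling_group k i) \<le> k"
  unfolding ruling_group_def using card_image_le[of "{1..k}"] by simp

lemma ruling_group_subset: "ruling_group k i \<subseteq> range (ruling (real i))"
  by (auto simp: ruling_group_def)

lemma card_UN_ruling_group: "card (\<Union>i<k. ruling_group k i) = k * k"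
proof -
  have "(\<Union>i<k. ruling_group k i) = (\<lambda>(i, j). ruling (real i) (real j)) ` ({..<k} \<times> {1..k})"
    by (auto simp: ruling_group_def)
  moreover have "inj_on (\<lambda>(i, j). ruling (real i) (real j)) ({..<k} \<times> {1..k})"
    by (auto simp: inj_on_def ruling_eq_iff)
  ultimately show ?thesis
    by (simp add: card_image card_cartesian_product)
qed

lemma card_le_sum_ruling_group:
  assumes "S \<subseteq> (\<Union>i<k. ruling_group k i)"
  shows "card S \<le> (\<Sum>i<k. card (S \<inter> ruling_group k i))"
proof -
  have "S = (\<Union>i<k. S \<inter> ruling_group k i)"
    using assms by blast
  then show ?thesis
    by (metis card_UN_le finite_lessThan)
qed

lemma card_stabbed_le:
  assumes S: "S \<subseteq> (\<Union>i<k. ruling_group k i)" and "stabbed S"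
  shows "card S \<le> 4 * k"
proof -
  obtain m where m: "stabbed_by S m"
    using \<open>stabbed S\<close> by (auto simp: stabbed_def)
  \<comment> \<open>Any point of \<open>m\<close> serves: if \<open>m\<close> lies in the plane
    \<open>y = i\<close>, then \<open>i = p $ 2\<close>, so \<open>p\<close> singles out the one
    group that may be stabbed in more than three lines.\<close>
  then obtain p where "p \<in> m"
    by (auto simp: stabbed_by_def is_line_iff affine_hull_2_eq_range)
  have le: "card (S \<inter> ruling_group k i) \<le> 3 + (if real i = p $ 2 then k else 0)" for i
  proof (cases "real i = p $ 2")
    case True
    have "card (S \<inter> ruling_group k i) \<le> card (ruling_group k i)"
      by (intro card_mono finite_ruling_group) simp
    with True show ?thesis
      using card_ruling_group_le[of k i] by simp
  next
    case False
    then have "card ((S \<inter> ruling_group k i) \<inter> range (ruling (real i))) \<le> 3"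
      using m \<open>p \<in> m\<close> by (intro card_stabbed_rulings_le[of _ m]) (auto simp: stabbed_by_def intro: bexI[of _ p])
    moreover have "(S \<inter> ruling_group k i) \<inter> range (ruling (real i)) = S \<inter> ruling_group k i"
      using ruling_group_subset by blast
    ultimately show ?thesis by simp
  qed
  have one: "card {i. i < k \<and> real i = p $ 2} \<le> 1"
    by (intro card_le_Suc0_iff_eq[THEN iffD2, folded One_nat_def]) auto
  have "card S \<le> (\<Sum>i<k. 3 + (if real i = p $ 2 then k else 0))"
    using card_le_sum_ruling_group[OF S] sum_mono[of "{..<k}", OF le] by (rule order_trans)
  also have "\<dots> = 3 * k + card {i. i < k \<and> real i = p $ 2} * k"
    by (simp add: sum.distrib sum.If_cases Int_def)
  also have "\<dots> \<le> 3 * k + 1 * k"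
    using one by (intro add_mono mult_right_mono) auto
  finally show ?thesis by simp
qed

text \<open>More than \<open>t\<close> lines of \<open>S\<close> in one group would include
  \<open>t\<close> lines that meet the common stabber of the group. The bound \<open>t\<close> per
  group, in place of \<open>t - 1\<close>, affects only the constant.\<close>

lemma card_no_stabbed_subset_le:
  assumes S: "S \<subseteq> (\<Union>i<k. ruling_group k i)"
    and no: "\<nexists>T. T \<subseteq> S \<and> card T = t \<and> stabbed T"
  shows "card S \<le> k * t"
proof -
  have le: "card (S \<inter> ruling_group k i) \<le> t" for i
  proof (rule ccontr)
    assume "\<not> card (S \<inter> ruling_group k i) \<le> t"
    then obtain T where T: "T \<subseteq> S \<inter> ruling_group k i" "card T = t"
      by (meson obtain_subset_with_card_n nat_le_linear)
    then have "stabbed T"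
      using ruling_group_subset by (intro stabbed_rulings) blast
    with T no show False by blast
  qed
  have "card S \<le> (\<Sum>i<k. t)"
    using card_le_sum_ruling_group[OF S] sum_mono[of "{..<k}", OF le] by (rule order_trans)
  then show ?thesis by simp
qed

section \<open>Choice of \<open>k\<close> and of the arrangement\<close>

lemma obtain_nat_sqrt_upper:
  fixes n :: nat
  obtains k :: nat where "n \<le> k * k" "real k \<le> 2 * sqrt (real n)"
proof
  let ?k = "nat \<lceil>sqrt (real n)\<rceil>"
  have "sqrt (real n) \<le> real ?k"
    by (rule real_nat_ceiling_ge)
  then have "sqrt (real n) * sqrt (real n) \<le> real ?k * real ?k"
    by (intro mult_mono' real_sqrt_ge_zero of_nat_0_le_iff)
  then have "real n \<le> real (?k * ?k)"
    by simp
  then show "n \<le> ?k * ?k"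
    by (simp only: of_nat_le_iff)
  \<comment> \<open>Rounding up adds less than \<open>1\<close>, which is at most
    \<open>sqrt n\<close> for positive \<open>n\<close>; for \<open>n = 0\<close> both sides are
    \<open>0\<close>.\<close>
  show "real ?k \<le> 2 * sqrt (real n)"
  proof (cases "n = 0")
    case False
    then have "1 \<le> sqrt (real n)"
      by simp
    then show ?thesis
      by linarith
  qed simp
qed

theorem theorem21:
  fixes t :: nat
  assumes "t \<ge> 4"
  shows "\<exists>C::real. \<forall>n::nat. \<exists>L. line_arrangement n L \<and>
           (\<forall>S\<subseteq>L. stabbed S \<longrightarrow> real (card S) \<le> C * sqrt (real n)) \<and>
           (\<forall>S\<subseteq>L. (\<nexists>T. T \<subseteq> S \<and> card T = t \<and> stabbed T) \<longrightarrow> real (card S) \<le> C * sqrt (real n))"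
\<comment> \<open>Both counts are at most \<open>k * t\<close>, and \<open>k\<close> is at most
  \<open>2 * sqrt n\<close>.\<close>
proof (intro exI[of _ "real (2 * t)"] allI)
  fix n :: nat
  obtain k where k: "n \<le> k * k" "real k \<le> 2 * sqrt (real n)"
    by (rule obtain_nat_sqrt_upper)
  obtain L where L: "L \<subseteq> (\<Union>i<k. ruling_group k i)" "card L = n"
    using obtain_subset_with_card_n[of n "\<Union>i<k. ruling_group k i"] k(1)
    by (auto simp: card_UN_ruling_group)
  have "finite L"
    using L(1) by (rule finite_subset) (auto simp: finite_ruling_group)
  then have "line_arrangement n L"
    using L by (fastforce simp: line_arrangement_def ruling_group_def is_line_ruling)
  moreover have bound: "real (card S) \<le> real (2 * t) * sqrt (real n)" if "card S \<le> k * t"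
    for S :: "(real ^ 3) set set"
  proof -
    have "real (card S) \<le> real k * real t"
      using that by (metis of_nat_le_iff of_nat_mult)
    also have "\<dots> \<le> 2 * sqrt (real n) * real t"
      using k(2) by (rule mult_right_mono) simp
    finally show ?thesis by (simp add: algebra_simps)
  qed
  moreover have "card S \<le> k * t" if "S \<subseteq> L" "stabbed S" for S
  proof -
    have "card S \<le> 4 * k"
      using that L(1) by (intro card_stabbed_le) auto
    \<comment> \<open>Here \<open>t \<ge> 4\<close> brings the stabbed sets under the bound shared
      with the other count.\<close>
    also have "\<dots> \<le> k * t"
      using assms by simp
    finally show ?thesis .
  qed
  moreover have "card S \<le> k * t"
    if "S \<subseteq> L" "\<nexists>T. T \<subseteq> S \<and> card T = t \<and> stabbed T" for S
    using that L(1) by (intro card_no_stabbed_subset_le) auto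
  ultimately show "\<exists>L. line_arrangement n L \<and>
      (\<forall>S\<subseteq>L. stabbed S \<longrightarrow> real (card S) \<le> real (2 * t) * sqrt (real n)) \<and>
      (\<forall>S\<subseteq>L. (\<nexists>T. T \<subseteq> S \<and> card T = t \<and> stabbed T) \<longrightarrow>
        real (card S) \<le> real (2 * t) * sqrt (real n))"
    by (intro exI[of _ L]) blast
qed

end
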